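(* Let $\alpha=(\alpha_n)_{n\in\mathbb N}$ be a positive, strictly increasing sequence with $\alpha_n\to\infty$ such that $E_\alpha$ is nuclear, and let $\mathsf C\in\mathcal L(E_\alpha)$ be the Cesàro operator. Then the range $(I-\mathsf C)^m(E_\alpha)$ is a closed subspace of $E_\alpha$ for each $m\in\mathbb N$.
   Context: $\mathbb N=\{1,2,3,\dots\}$. For a strictly positive sequence $w$ on $\mathbb N$, $c_0(w)=\{x\in\mathbb C^{\mathbb N}: \lim_{n\to\infty} w(n)|x_n|=0\}$, a Banach space with norm $\sup_n w(n)|x_n|$. Given $\alpha$, fix a strictly increasing sequence $(s_k)_{k\in\mathbb N}\subset(1,\infty)$ with $s_k\to\infty$ and put $v_k(n):=s_k^{-\alpha_n}$. Define $E_\alpha:=\mathrm{ind}_k\, c_0(v_k)$, i.e. $E_\alpha=\bigcup_k c_0(v_k)\subseteq\mathbb C^{\mathbb N}$ endowed with the finest locally convex Hausdorff topology making all inclusions $c_0(v_k)\hookrightarrow E_\alpha$ continuous; $E_\alpha$ does not depend on the choice of $(s_k)$. It is known that $E_\alpha$ is nuclear if and only if $\sup_n\frac{\log n}{\alpha_n}<\infty$. The Cesàro operator is $\mathsf Cx=\left(\frac{x_1+\dots+x_n}{n}\right)_{n\in\mathbb N}$, and it belongs to $\mathcal L(E_\alpha)$ (continuous linear operators from $E_\alpha$ into itself). *)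

theory Defs
  imports "HOL-Analysis.Analysis" "HOL-Library.Function_Algebras"
begin

section \<open>The vector space of complex sequences\<close>

text \<open>
  Sequences indexed by \<open>{1,2,3,\<dots>}\<close> are shifted to start at \<open>0\<close>: \<open>x n\<close> is the entry
  with index \<open>n + 1\<close>. The same shift applies to \<open>\<alpha>\<close> and to the auxiliary
  sequence \<open>s\<close>. Addition, subtraction and zero are pointwise (\<open>Function_Algebras\<close>).
\<close>

type_synonym cseq = "nat \<Rightarrow> complex"

definition seq_scale :: "complex \<Rightarrow> cseq \<Rightarrow> cseq" where
  "seq_scale c x = (\<lambda>n. c * x n)"

interpretation cseq: vector_space seq_scale
  by unfold_locales (auto simp: seq_scale_def fun_eq_iff algebra_simps)


section \<open>Locally convex topologies and inductive limits\<close>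

definition seq_convex :: "cseq set \<Rightarrow> bool" where
  "seq_convex V \<longleftrightarrow> (\<forall>x\<in>V. \<forall>y\<in>V. \<forall>t::real. 0 \<le> t \<and> t \<le> 1 \<longrightarrow>
     seq_scale (complex_of_real (1 - t)) x + seq_scale (complex_of_real t) y \<in> V)"

definition lc_hausdorff :: "cseq set \<Rightarrow> cseq topology \<Rightarrow> bool" where
  "lc_hausdorff E T \<longleftrightarrow>
     cseq.subspace E \<and> topspace T = E \<and> Hausdorff_space T \<and>
     continuous_map (prod_topology T T) T (\<lambda>(x, y). x + y) \<and>
     continuous_map (prod_topology euclidean T) T (\<lambda>(c, x). seq_scale c x) \<and>
     (\<forall>U. openin T U \<and> 0 \<in> U \<longrightarrow> (\<exists>V. openin T V \<and> 0 \<in> V \<and> V \<subseteq> U \<and> seq_convex V))"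

definition is_lc_inductive_limit :: "(nat \<Rightarrow> cseq topology) \<Rightarrow> cseq topology \<Rightarrow> bool" where
  "is_lc_inductive_limit X T \<longleftrightarrow>
     lc_hausdorff (\<Union>k. topspace (X k)) T \<and> (\<forall>k. continuous_map (X k) T id) \<and>
     (\<forall>S. lc_hausdorff (\<Union>k. topspace (X k)) S \<and> (\<forall>k. continuous_map (X k) S id) \<longrightarrow>
          (\<forall>U. openin S U \<longrightarrow> openin T U))"

definition lc_inductive_limit :: "(nat \<Rightarrow> cseq topology) \<Rightarrow> cseq topology" where
  "lc_inductive_limit X = (THE T. is_lc_inductive_limit X T)"


section \<open>Nuclear spaces\<close>

definition continuous_seminorm :: "cseq topology \<Rightarrow> (cseq \<Rightarrow> real) \<Rightarrow> bool" where
  "continuous_seminorm T p \<longleftrightarrow>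
     (\<forall>x\<in>topspace T. 0 \<le> p x) \<and>
     (\<forall>x\<in>topspace T. \<forall>y\<in>topspace T. p (x + y) \<le> p x + p y) \<and>
     (\<forall>c. \<forall>x\<in>topspace T. p (seq_scale c x) = cmod c * p x) \<and>
     continuous_map T euclideanreal p"

definition linear_functional_on :: "cseq set \<Rightarrow> (cseq \<Rightarrow> complex) \<Rightarrow> bool" where
  "linear_functional_on E f \<longleftrightarrow>
     (\<forall>x\<in>E. \<forall>y\<in>E. f (x + y) = f x + f y) \<and> (\<forall>c. \<forall>x\<in>E. f (seq_scale c x) = c * f x)"

text \<open>
  For seminorms \<open>p \<le> q\<close> on \<open>E\<close>, the local normed spaces are \<open>E / ker q\<close> and \<open>E / ker p\<close>, with the
  norms induced by \<open>q\<close> and \<open>p\<close>. The canonical map \<open>E / ker q \<rightarrow> E / ker p\<close> is nuclear if it has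
  a representation \<open>x \<mapsto> \<Sum>j. f j x * y j\<close>, convergent in \<open>E / ker p\<close>, with
  \<open>(\<Sum>j. \<parallel>f j\<parallel> * \<parallel>y j\<parallel>) < \<infinity>\<close>. The definition states this on representatives in \<open>E\<close>: a bounded
  functional on \<open>E / ker q\<close> of norm at most \<open>c\<close> is a linear functional on \<open>E\<close> bounded by \<open>c * q\<close>.
\<close>

definition nuclear_linking_map :: "cseq set \<Rightarrow> (cseq \<Rightarrow> real) \<Rightarrow> (cseq \<Rightarrow> real) \<Rightarrow> bool" where
  "nuclear_linking_map E q p \<longleftrightarrow>
     (\<exists>(f :: nat \<Rightarrow> cseq \<Rightarrow> complex) (c :: nat \<Rightarrow> real) (y :: nat \<Rightarrow> cseq).
        (\<forall>j. linear_functional_on E (f j) \<and> 0 \<le> c j \<and> (\<forall>x\<in>E. cmod (f j x) \<le> c j * q x) \<and> y j \<in> E) \<and>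
        summable (\<lambda>j. c j * p (y j)) \<and>
        (\<forall>x\<in>E. (\<lambda>N. p (x - (\<Sum>j<N. seq_scale (f j x) (y j)))) \<longlonglongrightarrow> 0))"

definition nuclear_space :: "cseq topology \<Rightarrow> bool" where
  "nuclear_space T \<longleftrightarrow>
     lc_hausdorff (topspace T) T \<and>
     (\<forall>p. continuous_seminorm T p \<longrightarrow>
        (\<exists>q. continuous_seminorm T q \<and> (\<forall>x\<in>topspace T. p x \<le> q x) \<and>
             nuclear_linking_map (topspace T) q p))"


section \<open>Weighted \<open>c\<^sub>0\<close> spaces and the space \<open>E\<^sub>\<alpha>\<close>\<close>

definition c0 :: "(nat \<Rightarrow> real) \<Rightarrow> cseq set" where
  "c0 w = {x. (\<lambda>n. w n * cmod (x n)) \<longlonglongrightarrow> 0}"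

text \<open>The supremum is unspecified when \<open>x\<close> is not \<open>w\<close>-bounded, and the locale \<open>Metric_space\<close> asks
  for a nonnegative distance between arbitrary points; hence the value \<open>0\<close> off \<open>c0 w\<close>.\<close>

definition c0_norm :: "(nat \<Rightarrow> real) \<Rightarrow> cseq \<Rightarrow> real" where
  "c0_norm w x = (if x \<in> c0 w then SUP n. w n * cmod (x n) else 0)"

definition c0_topology :: "(nat \<Rightarrow> real) \<Rightarrow> cseq topology" where
  "c0_topology w = Metric_space.mtopology (c0 w) (\<lambda>x y. c0_norm w (x - y))"

definition step_weight :: "(nat \<Rightarrow> real) \<Rightarrow> (nat \<Rightarrow> real) \<Rightarrow> nat \<Rightarrow> nat \<Rightarrow> real" where
  "step_weight s \<alpha> k n = s k powr (- \<alpha> n)"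

definition E_space :: "(nat \<Rightarrow> real) \<Rightarrow> (nat \<Rightarrow> real) \<Rightarrow> cseq set" where
  "E_space s \<alpha> = (\<Union>k. c0 (step_weight s \<alpha> k))"

definition E_topology :: "(nat \<Rightarrow> real) \<Rightarrow> (nat \<Rightarrow> real) \<Rightarrow> cseq topology" where
  "E_topology s \<alpha> = lc_inductive_limit (\<lambda>k. c0_topology (step_weight s \<alpha> k))"

definition cesaro :: "cseq \<Rightarrow> cseq" where
  "cesaro x = (\<lambda>n. (\<Sum>i\<le>n. x i) / of_nat (Suc n))"


section \<open>The topology of \<open>E\<^sub>\<alpha>\<close> is well defined\<close>

lemma c0_norm_upper:
  assumes "x \<in> c0 w"
  shows "w n * cmod (x n) \<le> c0_norm w x"
proof -
  have "convergent (\<lambda>n. w n * cmod (x n))"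
    using assms unfolding c0_def convergent_def by blast
  then have "bdd_above (range (\<lambda>n. w n * cmod (x n)))"
    by (intro Bseq_bdd_above convergent_imp_Bseq)
  then have "w n * cmod (x n) \<le> (SUP n. w n * cmod (x n))"
    by (rule cSUP_upper[OF UNIV_I])
  then show ?thesis
    using assms by (simp add: c0_norm_def)
qed

lemma subspace_c0:
  assumes w: "\<And>n. 0 < w n"
  shows "cseq.subspace (c0 w)"
proof (rule cseq.subspaceI)
  show "0 \<in> c0 w" by (simp add: c0_def)
next
  fix x y assume x: "x \<in> c0 w" and y: "y \<in> c0 w"
  have lim: "(\<lambda>n. w n * cmod (x n) + w n * cmod (y n)) \<longlonglongrightarrow> 0"
    using tendsto_add[of _ 0 sequentially _ 0] x y unfolding c0_def by fastforce
  have "norm (w n * cmod ((x + y) n)) \<le> w n * cmod (x n) + w n * cmod (y n)" for n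
    using w[of n] by (simp add: distrib_left[symmetric] norm_triangle_ineq abs_mult)
  then show "x + y \<in> c0 w"
    unfolding c0_def mem_Collect_eq
    by (intro Lim_null_comparison[OF _ lim] always_eventually allI)
next
  fix c x assume x: "x \<in> c0 w"
  have "(\<lambda>n. cmod c * (w n * cmod (x n))) \<longlonglongrightarrow> cmod c * 0"
    using x unfolding c0_def by (intro tendsto_mult_left) auto
  then show "seq_scale c x \<in> c0 w"
    by (simp add: c0_def seq_scale_def norm_mult ac_simps)
qed

lemma Metric_space_c0:
  assumes w: "\<And>n. 0 < w n"
  shows "Metric_space (c0 w) (\<lambda>x y. c0_norm w (x - y))"
proof
  fix x y :: cseq
  show "0 \<le> c0_norm w (x - y)"
  proof (cases "x - y \<in> c0 w")
    case True
    have "0 \<le> w 0 * cmod ((x - y) 0)"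
      using w[of 0] by simp
    also have "\<dots> \<le> c0_norm w (x - y)"
      by (rule c0_norm_upper[OF True])
    finally show ?thesis .
  qed (simp add: c0_norm_def)
  show "c0_norm w (x - y) = c0_norm w (y - x)"
    unfolding c0_norm_def c0_def by (simp add: norm_minus_commute)
next
  fix x y assume xy: "x \<in> c0 w" "y \<in> c0 w"
  then have d: "x - y \<in> c0 w"
    using cseq.subspace_diff[OF subspace_c0] w by blast
  have "x = y" if "c0_norm w (x - y) = 0"
  proof
    fix n
    have "w n * cmod (x n - y n) \<le> 0"
      using c0_norm_upper[OF d, of n] that by simp
    then show "x n = y n"
      using w[of n] by (simp add: mult_le_0_iff)
  qed
  then show "c0_norm w (x - y) = 0 \<longleftrightarrow> x = y"
    by (auto simp: c0_norm_def)
next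
  fix x y z assume xyz: "x \<in> c0 w" "y \<in> c0 w" "z \<in> c0 w"
  then have d: "x - y \<in> c0 w" "y - z \<in> c0 w" "x - z \<in> c0 w"
    using cseq.subspace_diff[OF subspace_c0] w by blast+
  have "w n * cmod ((x - z) n) \<le> c0_norm w (x - y) + c0_norm w (y - z)" for n
  proof -
    have "w n * cmod ((x - z) n) \<le> w n * cmod ((x - y) n) + w n * cmod ((y - z) n)"
      using w[of n] norm_triangle_ineq[of "x n - y n" "y n - z n"]
      by (simp add: distrib_left[symmetric])
    also have "\<dots> \<le> c0_norm w (x - y) + c0_norm w (y - z)"
      by (intro add_mono c0_norm_upper d)
    finally show ?thesis .
  qed
  then show "c0_norm w (x - z) \<le> c0_norm w (x - y) + c0_norm w (y - z)"
    unfolding c0_norm_def[of w "x - z"] using d(3) by (auto intro: cSUP_least)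
qed

lemma topspace_c0_topology:
  assumes "\<And>n. 0 < w n"
  shows "topspace (c0_topology w) = c0 w"
  unfolding c0_topology_def by (rule Metric_space.topspace_mtopology[OF Metric_space_c0[OF assms]])

lemma is_lc_inductive_limit_unique:
  assumes "is_lc_inductive_limit X S" "is_lc_inductive_limit X T"
  shows "S = T"
  using assms unfolding is_lc_inductive_limit_def topology_eq by blast

text \<open>The finest topology is the supremum of all admissible ones.\<close>

lemma is_lc_inductive_limit_exists:
  assumes adm: "lc_hausdorff (\<Union>k. topspace (X k)) T0" "\<And>k. continuous_map (X k) T0 id"
  shows "\<exists>T. is_lc_inductive_limit X T"
proof -
  define E where "E = (\<Union>k. topspace (X k))"
  define P where "P T \<longleftrightarrow> lc_hausdorff E T \<and> (\<forall>k. continuous_map (X k) T id)" for T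
  define B where "B = {U. \<exists>T. P T \<and> openin T U}"
  define S where "S = topology_generated_by B"
  have P0: "P T0"
    using adm by (simp add: P_def E_def)
  have topP: "topspace T = E" if "P T" for T
    using that by (simp add: P_def lc_hausdorff_def)
  have fine: "openin S U" if "P T" "openin T U" for T U
    unfolding S_def by (rule topology_generated_by_Basis) (use that in \<open>auto simp: B_def\<close>)
  have UB: "\<Union>B = E"
  proof
    show "\<Union>B \<subseteq> E"
      using topP openin_subset unfolding B_def by blast
    have "openin T0 E"
      using topP[OF P0] openin_topspace by metis
    then show "E \<subseteq> \<Union>B"
      using P0 unfolding B_def by blast
  qed
  then have topS: "topspace S = E"
    by (simp add: S_def)
  have idS: "continuous_map S T id" if "P T" for T
    using fine[OF that] topP[OF that] topS
    by (auto simp: continuous_map_def openin_subset Collect_conj_eq Int_absorb1 Int_commute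
        dest: openin_subset)
  have haus: "Hausdorff_space S"
    unfolding Hausdorff_space_def
  proof (intro allI impI)
    fix x y assume "x \<in> topspace S \<and> y \<in> topspace S \<and> x \<noteq> y"
    moreover have "Hausdorff_space T0"
      using P0 by (simp add: P_def lc_hausdorff_def)
    ultimately show "\<exists>U V. openin S U \<and> openin S V \<and> x \<in> U \<and> y \<in> V \<and> disjnt U V"
      using fine[OF P0] topP[OF P0] topS unfolding Hausdorff_space_def by metis
  qed
  have into_S: "continuous_map Z S g"
    if "\<And>T. P T \<Longrightarrow> continuous_map Z T g" for Z :: "'z topology" and g
    unfolding S_def
  proof (rule continuous_on_generated_topo)
    fix U assume "U \<in> B"
    then obtain T where T: "P T" "openin T U"
      by (auto simp: B_def)
    then show "openin Z (g -` U \<inter> topspace Z)"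
      using that[OF T(1)] by (simp add: continuous_map_alt)
  next
    show "g ` topspace Z \<subseteq> \<Union>B"
      using that[OF P0] topP[OF P0] UB by (auto simp: continuous_map_def)
  qed
  have add: "continuous_map (prod_topology S S) S (\<lambda>(x, y). x + y)"
  proof (rule into_S)
    fix T assume T: "P T"
    have "continuous_map (prod_topology S S) (prod_topology T T) (\<lambda>(x, y). (id x, id y))"
      unfolding continuous_map_prod_top using idS[OF T] continuous_map_id by blast
    moreover have "continuous_map (prod_topology T T) T (\<lambda>(x, y). x + y)"
      using T by (simp add: P_def lc_hausdorff_def)
    ultimately have "continuous_map (prod_topology S S) T ((\<lambda>(x, y). x + y) \<circ> (\<lambda>(x, y). (id x, id y)))"
      by (rule continuous_map_compose)
    then show "continuous_map (prod_topology S S) T (\<lambda>(x, y). x + y)"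
      by (simp add: o_def case_prod_unfold)
  qed
  have scale: "continuous_map (prod_topology euclidean S) S (\<lambda>(c, x). seq_scale c x)"
  proof (rule into_S)
    fix T assume T: "P T"
    have "continuous_map (prod_topology euclidean S) (prod_topology euclidean T)
            (\<lambda>(c::complex, x). (id c, id x))"
      unfolding continuous_map_prod_top using idS[OF T] continuous_map_id by blast
    moreover have "continuous_map (prod_topology euclidean T) T (\<lambda>(c, x). seq_scale c x)"
      using T by (simp add: P_def lc_hausdorff_def)
    ultimately have "continuous_map (prod_topology euclidean S) T
                       ((\<lambda>(c, x). seq_scale c x) \<circ> (\<lambda>(c, x). (id c, id x)))"
      by (rule continuous_map_compose)
    then show "continuous_map (prod_topology euclidean S) T (\<lambda>(c, x). seq_scale c x)"
      by (simp add: o_def case_prod_unfold)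
  qed
  have "\<exists>V. openin S V \<and> 0 \<in> V \<and> V \<subseteq> U \<and> seq_convex V"
    if "generate_topology_on B U" "0 \<in> U" for U
    using that
  proof induction
    case (Int a b)
    then obtain V W where "openin S V" "0 \<in> V" "V \<subseteq> a" "seq_convex V"
      "openin S W" "0 \<in> W" "W \<subseteq> b" "seq_convex W"
      by blast
    moreover have "seq_convex (V \<inter> W)"
      using \<open>seq_convex V\<close> \<open>seq_convex W\<close> unfolding seq_convex_def by blast
    ultimately show ?case
      by (intro exI[of _ "V \<inter> W"]) blast
  next
    case (UN K)
    then obtain k where "k \<in> K" "0 \<in> k"
      by blast
    with UN show ?case
      by (meson Union_upper subset_trans)
  next
    case (Basis U)
    then obtain T where T: "P T" "openin T U"
      by (auto simp: B_def)
    then obtain V where "openin T V" "0 \<in> V" "V \<subseteq> U" "seq_convex V"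
      using Basis unfolding P_def lc_hausdorff_def by blast
    then show ?case
      using fine[OF T(1)] by blast
  qed auto
  then have conv: "\<forall>U. openin S U \<and> 0 \<in> U \<longrightarrow> (\<exists>V. openin S V \<and> 0 \<in> V \<and> V \<subseteq> U \<and> seq_convex V)"
    unfolding S_def openin_topology_generated_by_iff by blast
  have "lc_hausdorff E S"
    unfolding lc_hausdorff_def
    using adm(1) topS haus add scale conv by (auto simp: lc_hausdorff_def E_def)
  moreover have "continuous_map (X k) S id" for k
    by (rule into_S) (simp add: P_def)
  ultimately have "is_lc_inductive_limit X S"
    unfolding is_lc_inductive_limit_def E_def[symmetric] using fine by (auto simp: P_def)
  then show ?thesis ..
qed

text \<open>An admissible topology on \<open>E\<^sub>\<alpha>\<close>: pointwise convergence.\<close>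

lemma lc_hausdorff_pointwise:
  assumes E: "cseq.subspace E"
  shows "lc_hausdorff E (subtopology euclidean E)"
proof -
  let ?T = "subtopology euclidean E :: cseq topology"
  have eucl: "(euclidean :: cseq topology) = product_topology (\<lambda>_. euclidean) UNIV"
    by (simp add: euclidean_product_topology)
  have coord: "continuous_map ?T euclidean (\<lambda>x. x n)" for n
    by (intro continuous_map_from_subtopology)
       (auto simp: eucl intro: continuous_map_product_projection[of _ UNIV])
  have into: "continuous_map Z ?T g"
    if "\<And>n. continuous_map Z euclidean (\<lambda>z. g z n)" "\<And>z. z \<in> topspace Z \<Longrightarrow> g z \<in> E"
    for Z :: "'z topology" and g
    using that by (auto simp: continuous_map_in_subtopology eucl continuous_map_componentwise_UNIV)
  have add: "continuous_map (prod_topology ?T ?T) ?T (\<lambda>(x, y). x + y)"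
  proof (rule into)
    fix n
    have "continuous_map (prod_topology ?T ?T) euclidean (\<lambda>z. fst z n + snd z n)"
      by (intro continuous_map_add
          continuous_map_compose[OF continuous_map_fst coord, unfolded o_def]
          continuous_map_compose[OF continuous_map_snd coord, unfolded o_def])
    then show "continuous_map (prod_topology ?T ?T) euclidean (\<lambda>z. (case z of (x, y) \<Rightarrow> x + y) n)"
      by (simp add: case_prod_unfold)
  qed (auto intro: cseq.subspace_add[OF E])
  have scale: "continuous_map (prod_topology euclidean ?T) ?T (\<lambda>(c, x). seq_scale c x)"
  proof (rule into)
    fix n
    have mult: "continuous_map Z euclidean (\<lambda>z. f z * g z)"
      if "continuous_map Z euclidean f" "continuous_map Z euclidean g"
      for Z :: "'z topology" and f g :: "'z \<Rightarrow> complex"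
      using that by (simp add: continuous_map_atin tendsto_mult)
    have "continuous_map (prod_topology euclidean ?T) euclidean (\<lambda>z. fst z * snd z n)"
      by (intro mult continuous_map_fst
          continuous_map_compose[OF continuous_map_snd coord, unfolded o_def])
    then show "continuous_map (prod_topology euclidean ?T) euclidean
                 (\<lambda>z. (case z of (c, x) \<Rightarrow> seq_scale c x) n)"
      by (simp add: case_prod_unfold seq_scale_def)
  qed (auto intro: cseq.subspace_scale[OF E])
  have "\<exists>V. openin ?T V \<and> 0 \<in> V \<and> V \<subseteq> U \<and> seq_convex V" if U: "openin ?T U" "0 \<in> U" for U
  proof -
    obtain W where W: "open W" "U = W \<inter> E"
      using U(1) by (auto simp: openin_subtopology)
    then obtain A where A: "(0::cseq) \<in> Pi\<^sub>E UNIV A" "\<And>i. open (A i)" "finite {i. A i \<noteq> UNIV}"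
        "Pi\<^sub>E UNIV A \<subseteq> W"
      using product_topology_open_contains_basis[of "\<lambda>_. euclidean" UNIV W 0] U(2)
      by (auto simp: open_fun_def)
    have "\<exists>r>0. ball 0 r \<subseteq> A i" for i
      using A(1) A(2)[of i] by (auto simp: PiE_def Pi_def open_contains_ball)
    then obtain r where r: "\<And>i. r i > 0" "\<And>i. ball 0 (r i) \<subseteq> A i"
      by metis
    define D where "D i = (if A i = UNIV then UNIV else ball (0::complex) (r i))" for i
    have convD: "convex (D i)" for i
      by (simp add: D_def)
    have "open (Pi\<^sub>E UNIV D)"
      unfolding open_fun_def
    proof (rule product_topology_basis)
      show "openin euclidean (D i)" for i
        by (simp add: D_def)
      show "finite {i. D i \<noteq> topspace euclidean}"
        by (rule finite_subset[OF _ A(3)]) (auto simp: D_def)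
    qed
    moreover have "Pi\<^sub>E UNIV D \<subseteq> W"
      using r(2) by (intro subset_trans[OF PiE_mono A(4)]) (auto simp: D_def)
    moreover have "0 \<in> Pi\<^sub>E UNIV D"
      using r(1) by (simp add: D_def PiE_def Pi_def)
    moreover have "seq_convex (Pi\<^sub>E UNIV D \<inter> E)"
      unfolding seq_convex_def
    proof (intro ballI allI impI IntI)
      fix x y and t :: real
      assume x: "x \<in> Pi\<^sub>E UNIV D \<inter> E" and y: "y \<in> Pi\<^sub>E UNIV D \<inter> E" and t: "0 \<le> t \<and> t \<le> 1"
      show "seq_scale (complex_of_real (1 - t)) x + seq_scale (complex_of_real t) y \<in> E"
        using x y by (auto intro: cseq.subspace_add[OF E] cseq.subspace_scale[OF E])
      have "(1 - t) *\<^sub>R x i + t *\<^sub>R y i \<in> D i" for i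
        using convexD_alt[OF convD] x y t by (auto simp: PiE_def Pi_def)
      then show "seq_scale (complex_of_real (1 - t)) x + seq_scale (complex_of_real t) y \<in> Pi\<^sub>E UNIV D"
        by (simp add: seq_scale_def scaleR_conv_of_real PiE_def Pi_def plus_fun_def)
    qed
    ultimately show ?thesis
      using W cseq.subspace_0[OF E]
      by (intro exI[of _ "Pi\<^sub>E UNIV D \<inter> E"]) (auto simp: openin_subtopology)
  qed
  moreover have "Hausdorff_space ?T"
    by (intro Hausdorff_space_subtopology) simp
  ultimately show ?thesis
    unfolding lc_hausdorff_def using E add scale by simp
qed

lemma continuous_map_c0_pointwise:
  assumes w: "\<And>n. 0 < w n" and E: "c0 w \<subseteq> E"
  shows "continuous_map (c0_topology w) (subtopology euclidean E) id"
proof -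
  interpret Metric_space "c0 w" "\<lambda>x y. c0_norm w (x - y)"
    by (rule Metric_space_c0[OF w])
  have "continuous_map mtopology euclidean (\<lambda>x. x n)" for n
  proof -
    have "continuous_map mtopology Met_TC.mtopology (\<lambda>x. x n)"
      unfolding metric_continuous_map[OF Met_TC.Metric_space_axioms]
    proof (intro conjI ballI allI impI)
      fix a and e :: real assume a: "a \<in> c0 w" and e: "0 < e"
      show "\<exists>\<delta>>0. \<forall>x. x \<in> c0 w \<and> c0_norm w (a - x) < \<delta> \<longrightarrow> dist (a n) (x n) < e"
      proof (intro exI[of _ "w n * e"] conjI allI impI)
        show "0 < w n * e" using w[of n] e by simp
        fix x assume x: "x \<in> c0 w \<and> c0_norm w (a - x) < w n * e"
        then have "a - x \<in> c0 w"
          using cseq.subspace_diff[OF subspace_c0] w a by blast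
        then have "w n * cmod ((a - x) n) < w n * e"
          using c0_norm_upper[of "a - x" w n] x by simp
        then show "dist (a n) (x n) < e"
          using w[of n] by (simp add: dist_norm)
      qed
    qed simp
    then show ?thesis by simp
  qed
  then show ?thesis
    using E unfolding c0_topology_def
    by (auto simp: continuous_map_in_subtopology euclidean_product_topology[symmetric]
        continuous_map_componentwise_UNIV)
qed

lemma step_weight_pos: "1 < s k \<Longrightarrow> 0 < step_weight s \<alpha> k n"
  by (simp add: step_weight_def)

lemma c0_step_mono:
  assumes \<alpha>: "\<And>n. 0 < \<alpha> n" and s: "\<And>k. 1 < s k" "strict_mono s" and "j \<le> k"
  shows "c0 (step_weight s \<alpha> j) \<subseteq> c0 (step_weight s \<alpha> k)"
proof
  fix x assume "x \<in> c0 (step_weight s \<alpha> j)"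
  then have lim: "(\<lambda>n. step_weight s \<alpha> j n * cmod (x n)) \<longlonglongrightarrow> 0"
    by (simp add: c0_def)
  have "s j \<le> s k"
    using s(2) \<open>j \<le> k\<close> by (simp add: strict_mono_less_eq)
  then have "step_weight s \<alpha> k n \<le> step_weight s \<alpha> j n" for n
    unfolding step_weight_def using s(1)[of j] \<alpha>[of n] by (intro powr_mono2') auto
  then have "norm (step_weight s \<alpha> k n * cmod (x n)) \<le> step_weight s \<alpha> j n * cmod (x n)" for n
    using step_weight_pos[of s k \<alpha> n] s(1) by (simp add: abs_mult mult_right_mono)
  then show "x \<in> c0 (step_weight s \<alpha> k)"
    unfolding c0_def mem_Collect_eq
    by (intro Lim_null_comparison[OF _ lim] always_eventually allI)
qed

lemma subspace_E_space:
  assumes \<alpha>: "\<And>n. 0 < \<alpha> n" and s: "\<And>k. 1 < s k" "strict_mono s"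
  shows "cseq.subspace (E_space s \<alpha>)"
proof -
  have sub: "cseq.subspace (c0 (step_weight s \<alpha> k))" for k
    using s(1) by (intro subspace_c0 step_weight_pos)
  show ?thesis
  proof (rule cseq.subspaceI)
    show "0 \<in> E_space s \<alpha>"
      using cseq.subspace_0[OF sub] by (auto simp: E_space_def)
  next
    fix x y assume "x \<in> E_space s \<alpha>" "y \<in> E_space s \<alpha>"
    then obtain i j where "x \<in> c0 (step_weight s \<alpha> i)" "y \<in> c0 (step_weight s \<alpha> j)"
      by (auto simp: E_space_def)
    then have "x \<in> c0 (step_weight s \<alpha> (max i j))" "y \<in> c0 (step_weight s \<alpha> (max i j))"
      using c0_step_mono[of \<alpha> s, OF \<alpha> s] max.cobounded1 max.cobounded2 by blast+
    then show "x + y \<in> E_space s \<alpha>"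
      using cseq.subspace_add[OF sub] by (auto simp: E_space_def)
  next
    fix c x assume "x \<in> E_space s \<alpha>"
    then show "seq_scale c x \<in> E_space s \<alpha>"
      using cseq.subspace_scale[OF sub] by (auto simp: E_space_def)
  qed
qed

theorem E_topology_is_lc_inductive_limit:
  assumes \<alpha>: "\<And>n. 0 < \<alpha> n" and s: "\<And>k. 1 < s k" "strict_mono s"
  shows "is_lc_inductive_limit (\<lambda>k. c0_topology (step_weight s \<alpha> k)) (E_topology s \<alpha>)"
    and "topspace (E_topology s \<alpha>) = E_space s \<alpha>"
proof -
  let ?X = "\<lambda>k. c0_topology (step_weight s \<alpha> k)"
  have E: "(\<Union>k. topspace (?X k)) = E_space s \<alpha>"
    using s(1) by (simp add: E_space_def topspace_c0_topology step_weight_pos)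
  have "\<exists>T. is_lc_inductive_limit ?X T"
  proof (rule is_lc_inductive_limit_exists)
    show "lc_hausdorff (\<Union>k. topspace (?X k)) (subtopology euclidean (E_space s \<alpha>))"
      unfolding E by (rule lc_hausdorff_pointwise[OF subspace_E_space[OF \<alpha> s]])
    show "continuous_map (?X k) (subtopology euclidean (E_space s \<alpha>)) id" for k
      using s(1) by (intro continuous_map_c0_pointwise step_weight_pos) (auto simp: E_space_def)
  qed
  then have "\<exists>!T. is_lc_inductive_limit ?X T"
    using is_lc_inductive_limit_unique by blast
  then show lim: "is_lc_inductive_limit ?X (E_topology s \<alpha>)"
    unfolding E_topology_def lc_inductive_limit_def by (rule theI')
  then show "topspace (E_topology s \<alpha>) = E_space s \<alpha>"
    by (simp add: is_lc_inductive_limit_def lc_hausdorff_def E)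
qed

end

theory Submission
  imports Defs "HOL-Real_Asymp.Real_Asymp"
begin

text \<open>
  The range is the same for every \<open>m \<ge> 1\<close>: it is the hyperplane of all \<open>x\<close> in \<open>E\<^sub>\<alpha>\<close> with
  \<open>x 0 = 0\<close>. This hyperplane is closed because the topology of \<open>E\<^sub>\<alpha>\<close>, being the finest admissible
  one, is finer than pointwise convergence.

  The inclusion of the range in the hyperplane is clear, since \<open>C\<close> fixes the first coordinate. For
  the converse it suffices that \<open>I - C\<close> maps the hyperplane onto itself, for then all powers have
  the same range. If \<open>y 0 = 0\<close>, the equation \<open>x - C x = y\<close> has the explicit solution
  \<open>x = y + log_sum y\<close>, where \<open>log_sum y\<close> has the entries \<open>\<Sum>j\<le>n. y j / j\<close> (\<open>cesaro_add_log_sum\<close>). If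
  \<open>y\<close> grows at most like \<open>t\<close> to the power \<open>\<alpha> n\<close>, with \<open>t\<close> one of the \<open>s k\<close>, then \<open>log_sum y\<close> grows
  faster by at most a factor of order \<open>1 + ln (n + 1)\<close>. Passing from one step \<open>s k\<close> to the next
  absorbs any factor that is polynomial in \<open>\<alpha> n\<close>. So it remains to bound \<open>ln n\<close> by a polynomial in
  \<open>\<alpha> n\<close>, and this is where nuclearity enters.

  The supremum norm with weight \<open>u n = exp (- (\<alpha> n)\<^sup>2)\<close> is a continuous seminorm, since
  \<open>u\<close> decays faster than all the step weights. Nuclearity factors this norm through a nuclear map
  from a seminorm \<open>q\<close>, and \<open>q\<close> is in turn dominated by the norm of the first step, of weight
  \<open>v\<close>. Thus the inclusion of \<open>c\<^sub>0(v)\<close> in \<open>c\<^sub>0(u)\<close>, which is a diagonal operator with entries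
  \<open>u n / v n\<close> between unweighted spaces, is nuclear, and a trace computation
  (\<open>nuclear_linking_trace\<close>) shows that these entries are summable. As \<open>u \<le> u / v\<close> and \<open>u\<close> is
  decreasing, \<open>n * u n\<close> is bounded, that is, \<open>ln n \<le> (\<alpha> n)\<^sup>2 + const\<close> (\<open>nuclear_growth\<close>).
\<close>

section \<open>Norm topologies on sequence spaces\<close>

lemma c0_dominated:
  assumes "x \<in> c0 v" and w: "\<And>n. 0 < w n" and le: "\<And>n. w n \<le> C * v n"
  shows "x \<in> c0 w"
proof -
  have "(\<lambda>n. C * (v n * cmod (x n))) \<longlonglongrightarrow> C * 0"
    using assms(1) unfolding c0_def by (intro tendsto_mult_left) auto
  then have lim: "(\<lambda>n. C * (v n * cmod (x n))) \<longlonglongrightarrow> 0"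
    by simp
  have "norm (w n * cmod (x n)) \<le> C * (v n * cmod (x n))" for n
    using w[of n] mult_right_mono[OF le[of n], of "cmod (x n)"] by (simp add: abs_mult ac_simps)
  then show ?thesis
    unfolding c0_def mem_Collect_eq
    by (intro Lim_null_comparison[OF _ lim] always_eventually allI)
qed

lemma c0_norm_least:
  assumes "x \<in> c0 w" and "\<And>n. w n * cmod (x n) \<le> B"
  shows "c0_norm w x \<le> B"
  using assms by (auto simp: c0_norm_def intro: cSUP_least)

lemma c0_norm_scale:
  assumes w: "\<And>n. 0 < w n" and x: "x \<in> c0 w"
  shows "c0_norm w (seq_scale c x) = cmod c * c0_norm w x"
proof -
  have le: "c0_norm w (seq_scale c x) \<le> cmod c * c0_norm w x" if "x \<in> c0 w" for c x
  proof (rule c0_norm_least)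
    show "seq_scale c x \<in> c0 w"
      using that w by (intro cseq.subspace_scale[OF subspace_c0])
    show "w n * cmod (seq_scale c x n) \<le> cmod c * c0_norm w x" for n
      using mult_left_mono[OF c0_norm_upper[OF that, of n], of "cmod c"]
      by (simp add: seq_scale_def norm_mult ac_simps)
  qed
  show ?thesis
  proof (cases "c = 0")
    case True
    then have "c0_norm w (seq_scale c x) = (SUP n::nat. 0::real)"
      by (simp add: seq_scale_def c0_norm_def c0_def)
    then show ?thesis
      using True by simp
  next
    case False
    have "x = seq_scale (inverse c) (seq_scale c x)"
      using False by (simp add: seq_scale_def fun_eq_iff)
    then have "c0_norm w x \<le> cmod (inverse c) * c0_norm w (seq_scale c x)"
      using le[of "seq_scale c x" "inverse c"] w x
      by (metis cseq.subspace_scale[OF subspace_c0])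
    then have "cmod c * c0_norm w x \<le> c0_norm w (seq_scale c x)"
      using False by (simp add: norm_inverse norm_divide field_simps)
    then show ?thesis
      using le[OF x, of c] by simp
  qed
qed

text \<open>
  A norm topology is admissible in the comparison that characterises the inductive limit as the
  finest locally convex topology; so a norm that is continuous on every step is continuous on the
  limit. The norm enters through its metric because the steps themselves are given that way.
\<close>
lemma lc_hausdorff_norm:
  assumes E: "cseq.subspace E"
    and M: "Metric_space E (\<lambda>x y. p (x - y))"
    and hom: "\<And>c x. x \<in> E \<Longrightarrow> p (seq_scale c x) = cmod c * p x"
  shows "lc_hausdorff E (Metric_space.mtopology E (\<lambda>x y. p (x - y)))"
    and "continuous_seminorm (Metric_space.mtopology E (\<lambda>x y. p (x - y))) p"
proof -
  interpret Metric_space E "\<lambda>x y. p (x - y)"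
    by (rule M)
  note subI = cseq.subspace_add[OF E] cseq.subspace_scale[OF E] cseq.subspace_diff[OF E]
    cseq.subspace_0[OF E]
  have nonneg0: "0 \<le> p x" for x
    using nonneg[of x 0] by simp
  have p0: "p 0 = 0"
    using mdist_zero[OF subI(4)] by simp
  have sym: "p (- x) = p x" for x
    using commute[of 0 x] by simp
  have tri: "p (x + y) \<le> p x + p y" if "x \<in> E" "y \<in> E" for x y
  proof -
    have "- y \<in> E"
      using that by (simp add: cseq.subspace_neg[OF E])
    from triangle[OF that(1) subI(4) this] show ?thesis
      by simp
  qed
  have rev: "\<bar>p x - p y\<bar> \<le> p (x - y)" if "x \<in> E" "y \<in> E" for x y
    using tri[of "x - y" y] tri[of "y - x" x] subI that sym[of "x - y"] by simp
  have "continuous_map mtopology Met_TC.mtopology p"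
    unfolding metric_continuous_map[OF Met_TC.Metric_space_axioms]
    using rev by (auto simp: dist_real_def intro: le_less_trans)
  then show "continuous_seminorm mtopology p"
    unfolding continuous_seminorm_def using tri hom nonneg0 by simp
  have add: "continuous_map (prod_topology mtopology mtopology) mtopology (\<lambda>(x, y). x + y)"
    unfolding continuous_map_to_metric
  proof (intro ballI allI impI)
    fix a and e :: real assume "a \<in> topspace (prod_topology mtopology mtopology)" and e: "0 < e"
    then obtain x y where a: "a = (x, y)" and xy: "x \<in> E" "y \<in> E"
      by auto
    show "\<exists>U. openin (prod_topology mtopology mtopology) U \<and> a \<in> U \<and>
        (\<forall>z\<in>U. (\<lambda>(x, y). x + y) z \<in> mball ((\<lambda>(x, y). x + y) a) e)"
      unfolding a
    proof (intro exI[of _ "mball x (e/2) \<times> mball y (e/2)"] conjI ballI)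
      show "openin (prod_topology mtopology mtopology) (mball x (e/2) \<times> mball y (e/2))"
        by (simp add: openin_prod_Times_iff)
      show "(x, y) \<in> mball x (e/2) \<times> mball y (e/2)"
        using xy e p0 by simp
      fix z assume "z \<in> mball x (e/2) \<times> mball y (e/2)"
      then obtain x' y' where z: "z = (x', y')" "x' \<in> E" "y' \<in> E" "p (x - x') < e/2" "p (y - y') < e/2"
        by auto
      have "p (x + y - (x' + y')) \<le> p (x - x') + p (y - y')"
        using tri[of "x - x'" "y - y'"] subI z xy by (simp add: algebra_simps)
      then show "(\<lambda>(x, y). x + y) z \<in> mball ((\<lambda>(x, y). x + y) (x, y)) e"
        using z xy subI by simp
    qed
  qed
  have scale: "continuous_map (prod_topology euclidean mtopology) mtopology (\<lambda>(c, x). seq_scale c x)"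
    unfolding continuous_map_to_metric
  proof (intro ballI allI impI)
    fix a and e :: real assume "a \<in> topspace (prod_topology (euclidean :: complex topology) mtopology)"
      and e: "0 < e"
    then obtain c x where a: "a = (c, x)" and x: "x \<in> E"
      by auto
    \<comment> \<open>The two radii make both summands of
      \<open>\<bar>c - c'\<bar> * p x + \<bar>c'\<bar> * p (x - x')\<close> at most \<open>e / 2\<close>; the cap \<open>d \<le> 1\<close> keeps \<open>\<bar>c'\<bar> \<le> \<bar>c\<bar> + 1\<close>.\<close>
    define d where "d = min 1 (e / (2 * (p x + 1)))"
    define d' where "d' = e / (2 * (cmod c + 1))"
    have d: "0 < d" "d \<le> 1" "d * p x \<le> e/2"
    proof -
      have "d * p x \<le> e / (2 * (p x + 1)) * (p x + 1)"
        using nonneg0[of x] e by (intro mult_mono) (auto simp: d_def)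
      also have "\<dots> = e/2"
        using nonneg0[of x] by (simp add: field_simps)
      finally show "d * p x \<le> e/2" .
    qed (use nonneg0[of x] e in \<open>auto simp: d_def intro!: divide_pos_pos add_nonneg_pos\<close>)
    have d': "0 < d'" "(cmod c + 1) * d' = e/2"
      using e norm_ge_zero[of c] by (auto simp: d'_def divide_simps add_nonneg_eq_0_iff add_nonneg_pos)
    show "\<exists>U. openin (prod_topology euclidean mtopology) U \<and> a \<in> U \<and>
        (\<forall>z\<in>U. (\<lambda>(c, x). seq_scale c x) z \<in> mball ((\<lambda>(c, x). seq_scale c x) a) e)"
      unfolding a
    proof (intro exI[of _ "ball c d \<times> mball x d'"] conjI ballI)
      show "openin (prod_topology euclidean mtopology) (ball c d \<times> mball x d')"
        by (simp add: openin_prod_Times_iff)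
      show "(c, x) \<in> ball c d \<times> mball x d'"
        using x d d' p0 by simp
      fix z assume "z \<in> ball c d \<times> mball x d'"
      then obtain c' x' where z: "z = (c', x')" "cmod (c - c') < d" "x' \<in> E" "p (x - x') < d'"
        by (auto simp: dist_norm)
      have "seq_scale c x - seq_scale c' x' = seq_scale (c - c') x + seq_scale c' (x - x')"
        by (simp add: seq_scale_def fun_eq_iff algebra_simps)
      then have "p (seq_scale c x - seq_scale c' x') \<le> cmod (c - c') * p x + cmod c' * p (x - x')"
        using tri[of "seq_scale (c - c') x" "seq_scale c' (x - x')"] subI hom z x by simp
      moreover have "cmod (c - c') * p x \<le> e/2"
        using mult_right_mono[of "cmod (c - c')" d "p x"] z d nonneg0[of x] by simp
      moreover have "cmod c' * p (x - x') < e/2"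
      proof -
        have "cmod c' \<le> cmod c + 1"
          using norm_triangle_ineq3[of c c'] z d by linarith
        then have "cmod c' * p (x - x') \<le> (cmod c + 1) * p (x - x')"
          using nonneg0 by (intro mult_right_mono)
        also have "\<dots> < (cmod c + 1) * d'"
          using z by (intro mult_strict_left_mono) (auto intro: add_nonneg_pos)
        finally show ?thesis
          using d' by simp
      qed
      ultimately have "p (seq_scale c x - seq_scale c' x') < e"
        by linarith
      then show "(\<lambda>(c, x). seq_scale c x) z \<in> mball ((\<lambda>(c, x). seq_scale c x) (c, x)) e"
        using z x subI by simp
    qed
  qed
  have conv: "\<exists>V. openin mtopology V \<and> 0 \<in> V \<and> V \<subseteq> U \<and> seq_convex V"
    if U: "openin mtopology U \<and> 0 \<in> U" for U
  proof -
    obtain r where r: "r > 0" "mball 0 r \<subseteq> U"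
      using U openin_mtopology by blast
    have mem: "x \<in> mball 0 r \<longleftrightarrow> x \<in> E \<and> p x < r" for x
      using sym[of x] subI by simp
    have "seq_convex (mball 0 r)"
      unfolding seq_convex_def
    proof (intro ballI allI impI)
      fix x y and t :: real
      assume x: "x \<in> mball 0 r" and y: "y \<in> mball 0 r" and t: "0 \<le> t \<and> t \<le> 1"
      let ?z = "seq_scale (complex_of_real (1 - t)) x + seq_scale (complex_of_real t) y"
      have "p ?z \<le> (1 - t) * p x + t * p y"
        using tri[of "seq_scale (complex_of_real (1 - t)) x" "seq_scale (complex_of_real t) y"]
          hom[of x "complex_of_real (1 - t)"] hom[of y "complex_of_real t"] x y t subI mem
        by (simp del: of_real_diff)
      also have "\<dots> < r"
        using convex_bound_lt[of "p x" r "p y" "1 - t" t] x y t mem by simp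
      finally have "p ?z < r" .
      moreover have "?z \<in> E"
        using x y by (intro subI) auto
      ultimately show "?z \<in> mball 0 r"
        by (simp only: mem)
    qed
    then show ?thesis
      using r subI p0 by (intro exI[of _ "mball 0 r"]) simp
  qed
  show "lc_hausdorff E mtopology"
    unfolding lc_hausdorff_def using E Hausdorff_space_mtopology add scale conv by simp
qed

text \<open>Continuity at the origin bounds \<open>q\<close> on a small ball of the step; homogeneity does the rest.\<close>
lemma continuous_seminorm_bounded_on_c0:
  assumes v: "\<And>n. 0 < v n" and q: "continuous_seminorm T q"
    and id: "continuous_map (c0_topology v) T id"
  obtains C where "0 \<le> C" "\<And>x. x \<in> c0 v \<Longrightarrow> q x \<le> C * c0_norm v x"
proof -
  interpret Metric_space "c0 v" "\<lambda>x y. c0_norm v (x - y)"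
    by (rule Metric_space_c0[OF v])
  note sub = subspace_c0[OF v]
  have mem0: "0 \<in> c0 v"
    by (rule cseq.subspace_0[OF sub])
  have cE: "c0 v \<subseteq> topspace T"
    using id by (auto simp: continuous_map_def topspace_c0_topology[OF v])
  have hom: "q (seq_scale c x) = cmod c * q x" if "x \<in> c0 v" for c x
    using q cE that by (auto simp: continuous_seminorm_def)
  have q0: "q 0 = 0"
    using hom[OF mem0, of 0] by (simp add: seq_scale_def zero_fun_def)
  have "continuous_map (c0_topology v) euclideanreal (q \<circ> id)"
    using q by (intro continuous_map_compose[OF id]) (simp add: continuous_seminorm_def)
  then have "continuous_map mtopology Met_TC.mtopology q"
    by (simp add: c0_topology_def)
  then have "\<forall>a\<in>c0 v. \<forall>e>0. \<exists>d>0. \<forall>x. x \<in> c0 v \<and> c0_norm v (a - x) < d \<longrightarrow> dist (q a) (q x) < e"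
    unfolding metric_continuous_map[OF Met_TC.Metric_space_axioms] by (rule conjunct2)
  from this[rule_format, OF mem0 zero_less_one]
  obtain d where d: "d > 0" "\<And>x. x \<in> c0 v \<and> c0_norm v (0 - x) < d \<Longrightarrow> dist (q 0) (q x) < 1"
    by auto
  have small: "q x \<le> 1" if "x \<in> c0 v" "c0_norm v x < d" for x
    using d(2)[of x] that commute[of 0 x] q0 by (simp add: dist_real_def)
  have n0: "0 \<le> c0_norm v x" for x
    using nonneg[of x 0] by simp
  show ?thesis
  proof
    show "0 \<le> 2 / d" using d by simp
    fix x assume x: "x \<in> c0 v"
    show "q x \<le> 2 / d * c0_norm v x"
    proof (cases "c0_norm v x = 0")
      case True
      then have "x = 0"
        using zero[OF x mem0] by simp
      then show ?thesis using q0 n0[of x] d by simp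
    next
      case False
      then have pos: "0 < c0_norm v x" using n0[of x] by simp
      define r where "r = d / (2 * c0_norm v x)"
      have r: "0 < r" using d pos by (simp add: r_def)
      have "q (seq_scale (of_real r) x) \<le> 1"
      proof (rule small)
        show "seq_scale (of_real r) x \<in> c0 v"
          by (rule cseq.subspace_scale[OF sub x])
        have "r * c0_norm v x = d / 2"
          using pos by (simp add: r_def)
        then show "c0_norm v (seq_scale (of_real r) x) < d"
          using r d by (simp add: c0_norm_scale[OF v x])
      qed
      then have "r * q x \<le> 1"
        using hom[OF x] r by simp
      then show ?thesis
        using pos d by (simp add: r_def field_simps)
    qed
  qed
qed


section \<open>The trace of a nuclear diagonal map\<close>

lemma seq_sum_apply: "(\<Sum>i\<in>I. g i) n = (\<Sum>i\<in>I. g i n)" for g :: "'i \<Rightarrow> cseq"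
  by (induction I rule: infinite_finite_induct) auto

lemma linear_functional_on_sum:
  assumes E: "cseq.subspace E" and f: "linear_functional_on E f" and "\<And>i. i \<in> I \<Longrightarrow> g i \<in> E"
  shows "f (\<Sum>i\<in>I. g i) = (\<Sum>i\<in>I. f (g i))"
proof -
  have "f (seq_scale 0 0) = 0 * f 0"
    using f cseq.subspace_0[OF E] unfolding linear_functional_on_def by blast
  then have f0: "f 0 = 0"
    by simp
  show ?thesis
    using assms(3)
  proof (induction I rule: infinite_finite_induct)
    case (insert i I)
    then have "(\<Sum>i\<in>I. g i) \<in> E"
      by (intro cseq.subspace_sum[OF E]) auto
    then show ?case
      using insert f by (simp add: linear_functional_on_def del: plus_fun_apply)
  qed (simp_all add: f0)
qed

definition unit_seq :: "nat \<Rightarrow> cseq" where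
  "unit_seq n = (\<lambda>i. if i = n then 1 else 0)"

lemma c0_finite_support:
  assumes "\<And>i. i \<ge> N \<Longrightarrow> x i = 0"
  shows "x \<in> c0 v"
  unfolding c0_def mem_Collect_eq
  by (intro tendsto_eventually eventually_sequentiallyI[of N]) (simp add: assms)

text \<open>
  Let \<open>a n = u n / v n\<close> and let \<open>\<Sum>j. f j \<otimes> y j\<close> be the nuclear representation. Reading it at
  the \<open>n\<close>-th coordinate of the \<open>n\<close>-th unit sequence \<open>e n\<close> gives \<open>1 = (\<Sum>j. f j (e n) * y j n)\<close>.
  Multiplying by \<open>a n\<close>, summing over \<open>n < N\<close> and exchanging the sums gives
  \<open>(\<Sum>n<N. a n) = (\<Sum>j. f j (z j))\<close>, where \<open>z j\<close> is the truncation of \<open>a n * y j n\<close>. The point of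
  the choice of \<open>a\<close> is that the \<open>v\<close>-norm of \<open>z j\<close> is at most the \<open>u\<close>-norm of \<open>y j\<close>; hence the
  right-hand side is bounded independently of \<open>N\<close> by the nuclear sum.
\<close>
lemma nuclear_linking_trace:
  assumes v: "\<And>n. 0 < v n" and u: "\<And>n. 0 < u n"
    and E: "cseq.subspace E" "c0 v \<subseteq> E" "E \<subseteq> c0 u"
    and C: "0 \<le> C" "\<And>x. x \<in> c0 v \<Longrightarrow> q x \<le> C * c0_norm v x"
    and nuc: "nuclear_linking_map E q (c0_norm u)"
  shows "\<exists>A. \<forall>N. (\<Sum>n<N. u n / v n) \<le> A"
proof -
  let ?p = "c0_norm u"
  obtain f c y where
    f: "\<And>j. linear_functional_on E (f j)" "\<And>j. 0 \<le> c j"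
       "\<And>j x. x \<in> E \<Longrightarrow> cmod (f j x) \<le> c j * q x" "\<And>j. y j \<in> E"
    and sm: "summable (\<lambda>j. c j * ?p (y j))"
    and lim: "\<And>x. x \<in> E \<Longrightarrow> (\<lambda>N. ?p (x - (\<Sum>j<N. seq_scale (f j x) (y j)))) \<longlonglongrightarrow> 0"
    using nuc unfolding nuclear_linking_map_def by blast
  have eE: "unit_seq n \<in> E" for n
    using c0_finite_support[of "Suc n" "unit_seq n" v] E(2) by (auto simp: unit_seq_def)
  have diag: "(\<lambda>j. f j (unit_seq n) * y j n) sums 1" for n
  proof -
    define r where "r N = unit_seq n - (\<Sum>j<N. seq_scale (f j (unit_seq n)) (y j))" for N
    have "r N \<in> E" for N
      unfolding r_def
      by (intro cseq.subspace_diff cseq.subspace_sum cseq.subspace_scale E(1) eE f(4))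
    then have "u n * cmod (r N n) \<le> ?p (r N)" for N
      using E(3) by (intro c0_norm_upper) auto
    then have r_le: "norm (r N n) \<le> ?p (r N) / u n" for N
      using u[of n] by (simp add: field_simps)
    have r_lim: "(\<lambda>N. ?p (r N) / u n) \<longlonglongrightarrow> 0"
      unfolding r_def by (intro tendsto_divide_zero lim eE)
    have "(\<lambda>N. r N n) \<longlonglongrightarrow> 0"
      by (rule Lim_null_comparison[OF always_eventually[OF allI[OF r_le]] r_lim])
    then have "(\<lambda>N. 1 - (\<Sum>j<N. f j (unit_seq n) * y j n)) \<longlonglongrightarrow> 0"
      by (simp add: r_def unit_seq_def seq_sum_apply seq_scale_def)
    from tendsto_diff[OF tendsto_const[of 1] this] show ?thesis
      by (simp add: sums_def)
  qed
  have "(\<Sum>n<N. u n / v n) \<le> (\<Sum>j. C * (c j * ?p (y j)))" for N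
  proof -
    define a where "a n = u n / v n" for n
    define z where "z j = (\<Sum>n<N. seq_scale (of_real (a n) * y j n) (unit_seq n))" for j
    have z: "z j i = (if i < N then of_real (a i) * y j i else 0)" for i j
      by (simp add: z_def seq_sum_apply seq_scale_def unit_seq_def if_distrib
          cong: if_cong)
    have zc: "z j \<in> c0 v" for j
      by (rule c0_finite_support[of N]) (simp add: z)
    have zn: "c0_norm v (z j) \<le> ?p (y j)" for j
    proof (rule c0_norm_least[OF zc])
      fix i
      have yj: "u i * cmod (y j i) \<le> ?p (y j)"
        using f(4) E(3) by (intro c0_norm_upper) auto
      have "0 \<le> u i * cmod (y j i)"
        using u[of i] by simp
      also note yj
      finally show "v i * cmod (z j i) \<le> ?p (y j)"
        using yj u[of i] v[of i] by (auto simp: z norm_mult norm_divide a_def)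
    qed
    have fz: "f j (z j) = (\<Sum>n<N. of_real (a n) * (f j (unit_seq n) * y j n))" for j
    proof -
      have "f j (z j) = (\<Sum>n<N. f j (seq_scale (of_real (a n) * y j n) (unit_seq n)))"
        unfolding z_def
        by (intro linear_functional_on_sum[OF E(1) f(1)] cseq.subspace_scale[OF E(1)] eE)
      then show ?thesis
        using f(1) eE by (simp add: linear_functional_on_def ac_simps)
    qed
    have sums_f: "(\<lambda>j. f j (z j)) sums (\<Sum>n<N. of_real (a n) * 1)"
      unfolding fz by (intro sums_sum sums_mult diag)
    have f_le: "cmod (f j (z j)) \<le> C * (c j * ?p (y j))" for j
    proof -
      have "cmod (f j (z j)) \<le> c j * q (z j)"
        using f(3) zc E(2) by blast
      also have "\<dots> \<le> c j * (C * ?p (y j))"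
        using order_trans[OF C(2)[OF zc] mult_left_mono[OF zn C(1)]] f(2) by (intro mult_left_mono)
      finally show ?thesis
        by (simp add: ac_simps)
    qed
    have sums_le: "(\<lambda>j. C * (c j * ?p (y j))) sums (\<Sum>j. C * (c j * ?p (y j)))"
      using sm by (intro summable_sums summable_mult)
    have "cmod (\<Sum>n<N. of_real (a n) * 1) \<le> (\<Sum>j. C * (c j * ?p (y j)))"
      by (rule norm_sums_le[OF sums_f sums_le f_le])
    moreover have "cmod (\<Sum>n<N. of_real (a n) * 1) = \<bar>\<Sum>n<N. a n\<bar>"
      by (simp flip: of_real_sum)
    ultimately show ?thesis
      by (simp add: a_def)
  qed
  then show ?thesis
    by blast
qed

section \<open>The space \<open>E\<^sub>\<alpha>\<close>: topology and nuclearity\<close>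

locale E_alpha =
  fixes \<alpha> s :: "nat \<Rightarrow> real"
  assumes alpha_pos: "\<And>n. 0 < \<alpha> n"
    and alpha_mono: "strict_mono \<alpha>"
    and alpha_top: "filterlim \<alpha> at_top sequentially"
    and s_gt1: "\<And>k. 1 < s k"
    and s_mono: "strict_mono s"
begin

abbreviation E where "E \<equiv> E_space s \<alpha>"
abbreviation T where "T \<equiv> E_topology s \<alpha>"
abbreviation v where "v \<equiv> step_weight s \<alpha>"

lemma v_pos: "0 < v k n"
  using s_gt1 by (rule step_weight_pos)

lemma subspace_E: "cseq.subspace E"
  by (intro subspace_E_space alpha_pos s_gt1 s_mono)

lemma topspace_T: "topspace T = E"
  by (intro E_topology_is_lc_inductive_limit alpha_pos s_gt1 s_mono)

lemma step_subset: "c0 (v k) \<subseteq> E"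
  by (auto simp: E_space_def)

lemma step_continuous: "continuous_map (c0_topology (v k)) T id"
  using E_topology_is_lc_inductive_limit(1)[of \<alpha> s] alpha_pos s_gt1 s_mono
  by (simp add: is_lc_inductive_limit_def)

lemma T_finest:
  assumes "lc_hausdorff E S" "\<And>k. continuous_map (c0_topology (v k)) S id" "openin S U"
  shows "openin T U"
proof -
  have "(\<Union>k. topspace (c0_topology (v k))) = E"
    by (simp add: E_space_def topspace_c0_topology v_pos)
  then show ?thesis
    using E_topology_is_lc_inductive_limit(1)[of \<alpha> s, OF alpha_pos s_gt1 s_mono] assms
    unfolding is_lc_inductive_limit_def by metis
qed

text \<open>Pointwise convergence is one of the topologies that \<open>T\<close> refines.\<close>
lemma closedin_pointwise:
  assumes "closed F"
  shows "closedin T (F \<inter> E)"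
proof -
  have "openin (subtopology euclidean E) (E - F)"
    using assms by (auto simp: openin_open Diff_eq open_Compl)
  then have "openin T (E - F)"
    using v_pos step_subset
    by (intro T_finest[OF lc_hausdorff_pointwise[OF subspace_E]] continuous_map_c0_pointwise)
  moreover have "topspace T - F \<inter> E = E - F"
    by (auto simp: topspace_T)
  ultimately show ?thesis
    by (simp add: closedin_def topspace_T)
qed

lemma continuous_weighted_norm:
  assumes w: "\<And>n. 0 < w n" and dom: "\<And>k. \<exists>C. \<forall>n. w n \<le> C * v k n"
  shows "E \<subseteq> c0 w" and "continuous_seminorm T (c0_norm w)"
proof -
  show sub: "E \<subseteq> c0 w"
    using c0_dominated[of _ _ w, OF _ w] dom unfolding E_space_def by blast
  interpret Metric_space E "\<lambda>x y. c0_norm w (x - y)"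
    using Metric_space.subspace[OF Metric_space_c0[OF w] sub] .
  note norm = lc_hausdorff_norm[OF subspace_E Metric_space_axioms]
  have hom: "c0_norm w (seq_scale c x) = cmod c * c0_norm w x" if "x \<in> E" for c x
    using c0_norm_scale[of w, OF w] sub that by blast
  have cont: "continuous_map (c0_topology (v k)) mtopology id" for k
  proof -
    interpret V: Metric_space "c0 (v k)" "\<lambda>x y. c0_norm (v k) (x - y)"
      by (rule Metric_space_c0[OF v_pos])
    obtain C where C: "\<And>n. w n \<le> C * v k n"
      using dom by blast
    have Cpos: "0 < C"
      using w[of 0] C[of 0] v_pos[of k 0] by (metis less_le_trans zero_less_mult_pos2)
    have le: "c0_norm w x \<le> C * c0_norm (v k) x" if x: "x \<in> c0 (v k)" for x
    proof (rule c0_norm_least)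
      show "x \<in> c0 w"
        using x step_subset sub by blast
      fix n
      have "w n * cmod (x n) \<le> C * (v k n * cmod (x n))"
        using mult_right_mono[OF C[of n], of "cmod (x n)"] by (simp add: ac_simps)
      also have "\<dots> \<le> C * c0_norm (v k) x"
        using Cpos c0_norm_upper[OF x] by (intro mult_left_mono) auto
      finally show "w n * cmod (x n) \<le> C * c0_norm (v k) x" .
    qed
    show ?thesis
      unfolding c0_topology_def V.metric_continuous_map[OF Metric_space_axioms]
    proof (intro conjI ballI allI impI)
      show "id ` c0 (v k) \<subseteq> E"
        using step_subset by simp
      fix a and e :: real assume a: "a \<in> c0 (v k)" and e: "0 < e"
      show "\<exists>d>0. \<forall>x. x \<in> c0 (v k) \<and> c0_norm (v k) (a - x) < d \<longrightarrow> c0_norm w (id a - id x) < e"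
      proof (intro exI[of _ "e / C"] conjI allI impI)
        show "0 < e / C"
          using e Cpos by simp
        fix x assume x: "x \<in> c0 (v k) \<and> c0_norm (v k) (a - x) < e / C"
        then have "c0_norm w (a - x) \<le> C * c0_norm (v k) (a - x)"
          using a by (intro le cseq.subspace_diff[OF subspace_c0] v_pos) auto
        also have "\<dots> < e"
          using x Cpos by (simp add: field_simps)
        finally show "c0_norm w (id a - id x) < e"
          by simp
      qed
    qed
  qed
  have "openin T U" if "openin mtopology U" for U
    using T_finest[OF norm(1) cont that] hom by blast
  then show "continuous_seminorm T (c0_norm w)"
    using norm(2) hom topspace_T unfolding continuous_seminorm_def continuous_map_def by auto
qed

text \<open>
  The weight \<open>exp (- (\<alpha> n)\<^sup>2)\<close> is dominated by every step weight, since \<open>(\<alpha> n)\<^sup>2\<close> outgrows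
  \<open>\<alpha> n * ln (s k)\<close>. So it defines a continuous norm, to which the trace estimate applies.
\<close>
lemma nuclear_growth:
  assumes "nuclear_space T"
  obtains A where "\<And>n. real (Suc n) \<le> A * exp ((\<alpha> n)\<^sup>2)"
proof -
  define u where "u n = exp (- (\<alpha> n)\<^sup>2)" for n
  have u: "0 < u n" for n
    by (simp add: u_def)
  have "\<exists>C. \<forall>n. u n \<le> C * v k n" for k
  proof (intro exI allI)
    fix n
    let ?l = "ln (s k)"
    have "0 \<le> (\<alpha> n - ?l)\<^sup>2 + (\<alpha> n)\<^sup>2 + ?l\<^sup>2"
      by simp
    then have "- (\<alpha> n)\<^sup>2 \<le> ?l\<^sup>2 - \<alpha> n * ?l"
      by (simp add: power2_diff)
    then have "u n \<le> exp (?l\<^sup>2 - \<alpha> n * ?l)"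
      by (simp add: u_def)
    also have "\<dots> = exp (?l\<^sup>2) * v k n"
      using s_gt1[of k] by (simp add: step_weight_def powr_def exp_diff exp_minus divide_inverse)
    finally show "u n \<le> exp (?l\<^sup>2) * v k n" .
  qed
  note uT = continuous_weighted_norm[of u, OF u this]
  obtain q where q: "continuous_seminorm T q" "nuclear_linking_map E q (c0_norm u)"
    using assms uT(2) unfolding nuclear_space_def topspace_T by blast
  obtain C where C: "0 \<le> C" "\<And>x. x \<in> c0 (v 0) \<Longrightarrow> q x \<le> C * c0_norm (v 0) x"
    using continuous_seminorm_bounded_on_c0[OF v_pos q(1) step_continuous] by blast
  obtain A where A: "\<And>N. (\<Sum>n<N. u n / v 0 n) \<le> A"
    using nuclear_linking_trace[OF v_pos u subspace_E step_subset uT(1) C q(2)] by blast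
  have "real (Suc n) \<le> A * exp ((\<alpha> n)\<^sup>2)" for n
  proof -
    have "real (Suc n) * u n = (\<Sum>i<Suc n. u n)"
      by simp
    also have "\<dots> \<le> (\<Sum>i<Suc n. u i / v 0 i)"
    proof (rule sum_mono)
      fix i assume "i \<in> {..<Suc n}"
      then have "\<alpha> i \<le> \<alpha> n"
        using alpha_mono by (simp add: strict_mono_less_eq)
      then have "u n \<le> u i"
        using alpha_pos[of i] by (simp add: u_def power_mono)
      moreover have "v 0 i \<le> 1"
        using s_gt1[of 0] alpha_pos[of i]
        by (simp add: step_weight_def powr_minus_divide ge_one_powr_ge_zero)
      then have "u i \<le> u i / v 0 i"
        using v_pos[of 0 i] u[of i] by (simp add: field_simps)
      ultimately show "u n \<le> u i / v 0 i"
        by simp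
    qed
    also have "\<dots> \<le> A"
      by (rule A)
    finally show ?thesis
      by (simp add: u_def exp_minus field_simps)
  qed
  then show ?thesis
    by (rule that)
qed

section \<open>Growth estimates and the equation \<open>x - C x = y\<close>\<close>

text \<open>
  The bound at \<open>n\<close> covers all earlier entries as well, because \<open>\<alpha>\<close> is increasing. This is the
  form in which it passes to averages.
\<close>
lemma E_growth:
  assumes "x \<in> E"
  obtains k M where "0 \<le> M" "\<And>i n. i \<le> n \<Longrightarrow> cmod (x i) \<le> M * s k powr \<alpha> n"
proof -
  obtain k where k: "x \<in> c0 (v k)"
    using assms by (auto simp: E_space_def)
  have M: "0 \<le> c0_norm (v k) x"
    using Metric_space.nonneg[OF Metric_space_c0[of "v k"], of x 0] v_pos by simp
  have "cmod (x i) \<le> c0_norm (v k) x * s k powr \<alpha> n" if "i \<le> n" for i n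
  proof -
    have "cmod (x i) \<le> c0_norm (v k) x * s k powr \<alpha> i"
      using c0_norm_upper[OF k, of i] s_gt1[of k]
      by (simp add: step_weight_def powr_minus field_simps)
    also have "s k powr \<alpha> i \<le> s k powr \<alpha> n"
      using that alpha_mono s_gt1[of k] by (simp add: strict_mono_less_eq powr_mono)
    then have "c0_norm (v k) x * s k powr \<alpha> i \<le> c0_norm (v k) x * s k powr \<alpha> n"
      by (rule mult_left_mono[OF _ M])
    finally show ?thesis .
  qed
  with M show ?thesis
    by (rule that)
qed

text \<open>
  Moving to the step \<open>s (Suc k)\<close> gains a factor \<open>r powr (- \<alpha> n)\<close> with \<open>r > 1\<close>, which beats the
  quadratic factor. The latter is tailored to the bound of \<open>nuclear_growth\<close>.
\<close>
lemma E_spaceI: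
  assumes "\<And>n. cmod (x n) \<le> M * (B + (\<alpha> n)\<^sup>2) * s k powr \<alpha> n"
  shows "x \<in> E"
proof -
  define r where "r = s (Suc k) / s k"
  have r: "1 < r"
    using s_gt1[of k] s_mono by (simp add: r_def strict_mono_less)
  have "((\<lambda>a. M * (B + a\<^sup>2) * r powr (- a)) \<longlongrightarrow> 0) at_top"
    using r by real_asymp
  then have lim: "(\<lambda>n. M * (B + (\<alpha> n)\<^sup>2) * r powr (- \<alpha> n)) \<longlonglongrightarrow> 0"
    using alpha_top by (rule filterlim_compose)
  have "norm (v (Suc k) n * cmod (x n)) \<le> M * (B + (\<alpha> n)\<^sup>2) * r powr (- \<alpha> n)" for n
  proof -
    have "v (Suc k) n * cmod (x n) \<le> v (Suc k) n * (M * (B + (\<alpha> n)\<^sup>2) * s k powr \<alpha> n)"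
      using v_pos[of "Suc k" n] assms by (intro mult_left_mono) auto
    also have "\<dots> = M * (B + (\<alpha> n)\<^sup>2) * r powr (- \<alpha> n)"
      using s_gt1[of k] s_gt1[of "Suc k"]
      by (simp add: r_def step_weight_def powr_divide powr_minus field_simps)
    finally show ?thesis
      using v_pos[of "Suc k" n] by (simp add: abs_mult)
  qed
  then have "x \<in> c0 (v (Suc k))"
    unfolding c0_def mem_Collect_eq
    by (intro Lim_null_comparison[OF _ lim] always_eventually allI)
  then show ?thesis
    using step_subset by blast
qed

lemma cesaro_E:
  assumes "x \<in> E"
  shows "cesaro x \<in> E"
proof -
  obtain k M where M: "0 \<le> M" "\<And>i n. i \<le> n \<Longrightarrow> cmod (x i) \<le> M * s k powr \<alpha> n"
    by (rule E_growth[OF assms]) (rule that)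
  have "cmod (cesaro x n) \<le> 1 * (M + (\<alpha> n)\<^sup>2) * s k powr \<alpha> n" for n
  proof -
    have "cmod (\<Sum>i\<le>n. x i) \<le> (\<Sum>i\<le>n. M * s k powr \<alpha> n)"
      using M(2) by (intro sum_norm_le) simp
    then have "cmod (cesaro x n) \<le> M * s k powr \<alpha> n"
      by (simp add: cesaro_def norm_divide field_simps del: of_nat_Suc)
    also have "\<dots> \<le> 1 * (M + (\<alpha> n)\<^sup>2) * s k powr \<alpha> n"
      by (simp add: mult_right_mono)
    finally show ?thesis .
  qed
  then show ?thesis
    by (rule E_spaceI)
qed

end

text \<open>
  The term \<open>j = 0\<close> is \<open>y 0 / 0 = 0\<close>, so the sum effectively starts at \<open>1\<close>.
\<close>
definition log_sum :: "cseq \<Rightarrow> cseq" where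
  "log_sum y n = (\<Sum>j\<le>n. y j / of_nat j)"

text \<open>
  With \<open>x = y + \<sigma>\<close> the equation \<open>x - C x = y\<close> says that \<open>\<sigma>\<close> is the sequence of means of \<open>x\<close>.
  Means satisfy \<open>\<sigma> (n + 1) - \<sigma> n = (x (n + 1) - \<sigma> (n + 1)) / (n + 1) = y (n + 1) / (n + 1)\<close>, which
  forces \<open>\<sigma>\<close> to be the sum below up to the free constant \<open>\<sigma> 0\<close>, taken to be \<open>0\<close> here.
\<close>
lemma cesaro_add_log_sum:
  assumes "y 0 = 0"
  shows "cesaro (y + log_sum y) = log_sum y"
proof -
  have "(\<Sum>i\<le>n. y i + log_sum y i) = of_nat (Suc n) * log_sum y n" for n
  proof (induction n)
    case 0
    then show ?case
      using assms by (simp add: log_sum_def)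
  next
    case (Suc n)
    have "log_sum y (Suc n) = log_sum y n + y (Suc n) / of_nat (Suc n)"
      by (simp add: log_sum_def)
    then have "y (Suc n) = of_nat (Suc n) * (log_sum y (Suc n) - log_sum y n)"
      by (simp del: of_nat_Suc)
    then show ?case
      using Suc by (simp add: algebra_simps)
  qed
  then show ?thesis
    by (simp add: cesaro_def fun_eq_iff del: of_nat_Suc)
qed

lemma norm_log_sum_le:
  assumes "\<And>j. j \<le> n \<Longrightarrow> cmod (y j) \<le> B"
  shows "cmod (log_sum y n) \<le> B * (1 + ln (real (Suc n)))"
proof -
  have B: "0 \<le> B"
    using assms[of 0] norm_ge_zero[of "y 0"] by linarith
  have "cmod (log_sum y n) \<le> (\<Sum>j\<le>n. B * inverse (real j))"
    unfolding log_sum_def using assms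
    by (intro sum_norm_le) (simp add: norm_mult norm_inverse divide_inverse mult_right_mono)
  also have "\<dots> = B * harm n"
    by (simp add: harm_def sum_distrib_left atMost_atLeast0 sum.atLeast_Suc_atMost)
  also have "\<dots> \<le> B * harm (Suc n)"
    using B by (intro mult_left_mono harm_mono) auto
  also have "\<dots> \<le> B * (1 + ln (real (Suc n)))"
    using decseqD[OF decseq_harm_diff_ln, of 0 n] B by (intro mult_left_mono) (auto simp: harm_expand)
  finally show ?thesis .
qed

context E_alpha
begin

lemma log_sum_E:
  assumes "nuclear_space T" and "y \<in> E"
  shows "log_sum y \<in> E"
proof -
  obtain k M where M: "0 \<le> M" "\<And>i n. i \<le> n \<Longrightarrow> cmod (y i) \<le> M * s k powr \<alpha> n"
    by (rule E_growth[OF assms(2)]) (rule that)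
  obtain A where A: "\<And>n. real (Suc n) \<le> A * exp ((\<alpha> n)\<^sup>2)"
    by (rule nuclear_growth[OF assms(1)]) (rule that)
  have "0 < A * exp ((\<alpha> 0)\<^sup>2)"
    using A[of 0] by simp
  then have Apos: "0 < A"
    by (simp add: zero_less_mult_iff)
  have "cmod (log_sum y n) \<le> M * ((1 + ln A) + (\<alpha> n)\<^sup>2) * s k powr \<alpha> n" for n
  proof -
    have "cmod (log_sum y n) \<le> (M * s k powr \<alpha> n) * (1 + ln (real (Suc n)))"
      by (rule norm_log_sum_le) (rule M(2))
    also have "ln (real (Suc n)) \<le> ln (A * exp ((\<alpha> n)\<^sup>2))"
      using A[of n] by (intro ln_mono) auto
    then have "(M * s k powr \<alpha> n) * (1 + ln (real (Suc n))) \<le> (M * s k powr \<alpha> n) * ((1 + ln A) + (\<alpha> n)\<^sup>2)"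
      using M(1) Apos by (intro mult_left_mono) (auto simp: ln_mult)
    finally show ?thesis
      by (simp add: ac_simps)
  qed
  then show ?thesis
    by (rule E_spaceI)
qed

text \<open>
  The solution \<open>y + log_sum y\<close> again vanishes at \<open>0\<close>, so already the hyperplane is mapped onto
  itself. Stating this for every \<open>F\<close> between the hyperplane and \<open>E\<close> serves both the first
  application of \<open>I - C\<close> and all later ones.
\<close>
lemma range_id_minus_cesaro:
  assumes "nuclear_space T" and F: "{x \<in> E. x 0 = 0} \<subseteq> F" "F \<subseteq> E"
  shows "(\<lambda>x. x - cesaro x) ` F = {x \<in> E. x 0 = 0}"
proof (intro subset_antisym subsetI)
  fix y assume "y \<in> (\<lambda>x. x - cesaro x) ` F"
  then obtain x where "x \<in> E" "y = x - cesaro x"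
    using F(2) by blast
  then show "y \<in> {x \<in> E. x 0 = 0}"
    using cseq.subspace_diff[OF subspace_E] cesaro_E by (simp add: cesaro_def)
next
  fix y assume y: "y \<in> {x \<in> E. x 0 = 0}"
  then have "y + log_sum y \<in> F"
    using F(1) log_sum_E[OF assms(1)] cseq.subspace_add[OF subspace_E]
    by (auto simp: log_sum_def)
  moreover have "y = (y + log_sum y) - cesaro (y + log_sum y)"
    using y by (simp add: cesaro_add_log_sum)
  ultimately show "y \<in> (\<lambda>x. x - cesaro x) ` F"
    by (intro image_eqI[where x = "y + log_sum y"])
qed

lemma range_power_id_minus_cesaro:
  assumes "nuclear_space T"
  shows "((\<lambda>x. x - cesaro x) ^^ Suc m) ` E = {x \<in> E. x 0 = 0}"
proof (induction m)
  case 0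
  have "(\<lambda>x. x - cesaro x) ` E = {x \<in> E. x 0 = 0}"
    by (intro range_id_minus_cesaro[OF assms]) auto
  then show ?case
    by (simp only: funpow.simps comp_id)
next
  case (Suc m)
  have "((\<lambda>x. x - cesaro x) ^^ Suc (Suc m)) ` E
      = (\<lambda>x. x - cesaro x) ` (((\<lambda>x. x - cesaro x) ^^ Suc m) ` E)"
    by (simp only: funpow.simps(2)[of "Suc m"] image_comp)
  also have "\<dots> = {x \<in> E. x 0 = 0}"
    unfolding Suc by (intro range_id_minus_cesaro[OF assms]) auto
  finally show ?case .
qed

end

theorem proposition4p3:
  fixes \<alpha> s :: "nat \<Rightarrow> real" and m :: nat
  assumes "\<And>n. 0 < \<alpha> n" and "strict_mono \<alpha>" and "filterlim \<alpha> at_top sequentially"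
    and "\<And>k. 1 < s k" and "strict_mono s" and "filterlim s at_top sequentially"
    and "nuclear_space (E_topology s \<alpha>)"
    and "1 \<le> m"
  shows "cseq.subspace (((\<lambda>x. x - cesaro x) ^^ m) ` E_space s \<alpha>) \<and>
    closedin (E_topology s \<alpha>) (((\<lambda>x. x - cesaro x) ^^ m) ` E_space s \<alpha>)"
proof -
  interpret E_alpha \<alpha> s
    by unfold_locales (use assms in auto)
  obtain m' where m: "m = Suc m'"
    using \<open>1 \<le> m\<close> by (cases m) auto
  have range: "((\<lambda>x. x - cesaro x) ^^ m) ` E = {x \<in> E. x 0 = 0}"
    unfolding m by (rule range_power_id_minus_cesaro[OF assms(7)])
  have "cseq.subspace {x \<in> E. x 0 = 0}"
    using cseq.subspace_0[OF subspace_E] cseq.subspace_add[OF subspace_E]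
      cseq.subspace_scale[OF subspace_E]
    by (intro cseq.subspaceI) (auto simp: seq_scale_def)
  moreover have "closedin T ({x. x 0 = 0} \<inter> E)"
    by (intro closedin_pointwise closed_Collect_eq continuous_on_product_coordinates continuous_on_const)
  then have "closedin T {x \<in> E. x 0 = 0}"
    by (simp add: Int_def conj_commute)
  ultimately show ?thesis
    unfolding range by blast
qed

end
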